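(* There exists an absolute constant structure as follows: for every $\epsilon>0$ there is a constant $C_\epsilon>0$ such that for every odd prime $p$, every integer $c$ with $\gcd(c,p)=1$, and every positive integer $H \ge C_\epsilon\, p^{1/4+\epsilon}$, there exist $X, Y \in \{0,1,\dots,p-1\}$ such that \[ |H_c \cap B(X,Y;H)| \ge 2 . \]
   Context: Let $p>2$ be a prime and $c$ an integer with $\gcd(c,p)=1$. The modular hyperbola is $H_c := \{(x,y) : x,y \in \mathbb{Z}/p\mathbb{Z},\ xy \equiv c \pmod p\}$. For integers $X,Y$ and a positive integer $H$, the box is $B(X,Y;H) := \{(x,y) : x \equiv X + i \pmod p,\ y \equiv Y + j \pmod p \text{ for some } 1\le i,j\le H\}$, viewed as a set of pairs of residues modulo $p$. $|S|$ denotes the number of elements of a set $S$. *)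

theory Defs
  imports Complex_Main "HOL-Number_Theory.Number_Theory"
begin

text \<open>Residues modulo \<open>p\<close> are represented by their least nonnegative integer representatives
  \<open>0, \<dots>, p - 1\<close>, so that cardinalities of the sets below count pairs of residue classes.\<close>

definition modular_hyperbola :: "nat \<Rightarrow> int \<Rightarrow> (int \<times> int) set" where
  "modular_hyperbola p c =
     {(x, y). x \<in> {0..<int p} \<and> y \<in> {0..<int p} \<and> [x * y = c] (mod int p)}"

definition modular_box :: "nat \<Rightarrow> int \<Rightarrow> int \<Rightarrow> nat \<Rightarrow> (int \<times> int) set" where
  "modular_box p X Y H =
     {(x, y). x \<in> {0..<int p} \<and> y \<in> {0..<int p} \<and>
        (\<exists>i\<in>{1..int H}. \<exists>j\<in>{1..int H}. [x = X + i] (mod int p) \<and> [y = Y + j] (mod int p))}"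

end

theory Submission
  imports Defs "HOL-Analysis.Harmonic_Numbers" "HOL-Real_Asymp.Real_Asymp"
    "HOL-Computational_Algebra.Polynomial_Factorial"
begin

text \<open>If \<open>a b (a b - 4 c)\<close> is a square modulo \<open>p\<close>, then \<open>b x\<^sup>2 + a b x + a c = 0\<close> is solvable and
  \<open>(x, c / x)\<close>, \<open>(x + a, c / x + b)\<close> are two points of the hyperbola. So suppose that
  \<open>a b (a b - 4 c)\<close> is a non-residue for all \<open>1 \<le> a, b < H\<close>. Writing \<open>a = q j\<close> with \<open>j \<le> m\<close>
  and \<open>t = - 4 c / (b q)\<close>, this says \<open>\<chi>(t + j) = - \<chi>(j)\<close> for all \<open>j \<le> m\<close>, where \<open>\<chi>\<close> is the
  Legendre symbol. With \<open>2\<^sup>m\<close> about \<open>p\<close>, the Weil bound leaves at most about \<open>\<surd>p\<close> (up to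
  logarithms) residues \<open>t\<close> with this prescribed pattern, whereas the products \<open>b q\<close> with
  \<open>b, q \<le> N\<close> take at least \<open>N\<^sup>2 / (1 + ln N)\<^sup>2\<close> values, which is larger once \<open>N\<close> exceeds
  \<open>p\<close> to the power \<open>1/4 + \<epsilon>/2\<close>. The Weil bound is proved by Stepanov's method, with \<open>\<int>[x]\<close> and
  divisibility by the constant polynomial \<open>p\<close> in place of polynomials over the prime field.\<close>

section \<open>Multiple roots of integer polynomials modulo a prime\<close>

lemma const_poly_dvd_poly: "[:c:] dvd P \<Longrightarrow> c dvd poly P x" for c :: "'a::comm_ring_1"
  by (auto elim!: dvdE)

lemma const_poly_dvd_pderiv: "[:c:] dvd P \<Longrightarrow> [:c:] dvd pderiv P" for c :: "'a::idom"
  by (auto simp: const_poly_dvd_iff coeff_pderiv)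

lemma const_poly_not_dvd_monic:
  fixes c :: int
  assumes "\<not> c dvd 1" "lead_coeff P = 1"
  shows "\<not> [:c:] dvd P"
  using assms unfolding const_poly_dvd_iff by metis

lemma higher_pderiv_pcompose_linear:
  "(pderiv ^^ k) (pcompose P [:u, 1:]) = pcompose ((pderiv ^^ k) P) [:u, 1:]"
  for P :: "'a::idom poly"
  by (induction k) (simp_all add: pderiv_pcompose pderiv_pCons)

text \<open>Translation commutes with differentiation, so the claim reduces to the expansion at 0.
  The factorial stays on the right because it cannot be divided out over the integers.\<close>

lemma higher_pderiv_poly_eq_Taylor_coeff:
  "poly ((pderiv ^^ k) P) u = fact k * coeff (pcompose P [:u, 1:]) k" for P :: "int poly"
proof -
  have "poly ((pderiv ^^ k) P) u = coeff ((pderiv ^^ k) (pcompose P [:u, 1:])) 0"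
    by (simp add: higher_pderiv_pcompose_linear poly_0_coeff_0[symmetric] poly_pcompose)
  also have "\<dots> = fact k * coeff (pcompose P [:u, 1:]) k"
    by (simp add: coeff_higher_pderiv pochhammer_fact)
  finally show ?thesis .
qed

lemma pcompose_power: "pcompose (P ^ n) Q = pcompose P Q ^ n" for P Q :: "'a::idom poly"
  by (induction n) (simp_all add: pcompose_mult pcompose_1)

text \<open>For \<open>k < l \<le> p\<close> the factorial of \<open>k\<close> is a unit modulo
  \<open>p\<close>, so vanishing derivatives force vanishing Taylor coefficients at
  \<open>u\<close>. The expansion is cut at order \<open>l\<close> and its lower part is a multiple
  of \<open>p\<close>.\<close>

lemma linear_power_dvd_mod_prime:
  fixes p :: nat and P :: "int poly"
  assumes p: "prime p" and "l \<le> p"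
    and der: "\<And>k. k < l \<Longrightarrow> int p dvd poly ((pderiv ^^ k) P) u"
  shows "\<exists>R. [:int p:] dvd P - [:-u, 1:] ^ l * R"
proof -
  define Q where "Q = pcompose P [:u, 1:]"
  have dvd: "int p dvd coeff Q k" if "k < l" for k
  proof -
    have "int p dvd fact k * coeff Q k"
      using der[OF that] by (simp add: higher_pderiv_poly_eq_Taylor_coeff Q_def)
    moreover have "\<not> int p dvd fact k"
    proof
      assume "int p dvd fact k"
      then have "p dvd fact k" by (metis of_nat_dvd_iff of_nat_fact)
      then show False using p that \<open>l \<le> p\<close> by (simp add: prime_dvd_fact_iff)
    qed
    ultimately show ?thesis using p by (simp add: prime_dvd_mult_iff)
  qed
  have "[:int p:] dvd poly_cutoff l Q"
    by (auto simp: const_poly_dvd_iff coeff_poly_cutoff dvd)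
  then obtain S where S: "poly_cutoff l Q = [:int p:] * S" by (elim dvdE)
  have Q: "Q = monom 1 l * poly_shift l Q + [:int p:] * S"
    unfolding S[symmetric]
    by (intro poly_eqI) (auto simp: coeff_poly_cutoff coeff_monom_mult coeff_poly_shift)
  have "P = pcompose Q [:-u, 1:]"
    by (simp add: Q_def pcompose_assoc[symmetric] pcompose_pCons)
  also have "\<dots> = [:-u, 1:] ^ l * pcompose (poly_shift l Q) [:-u, 1:] + [:int p:] * pcompose S [:-u, 1:]"
    by (subst Q) (simp add: pcompose_add pcompose_mult monom_altdef pcompose_power pcompose_smult pcompose_pCons)
  finally have "P - [:-u, 1:] ^ l * pcompose (poly_shift l Q) [:-u, 1:] = [:int p:] * pcompose S [:-u, 1:]"
    by simp
  then show ?thesis by (metis dvd_triv_left)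
qed

text \<open>Replaces the coprimality of \<open>g\<close> and a power of \<open>x - u\<close> over
  the prime field. One linear factor is gained at a time, using that the constant polynomial
  \<open>p\<close> is a prime element.\<close>

lemma mult_linear_power_dvd_mod_prime:
  fixes p :: nat and P g :: "int poly"
  assumes p: "prime p"
    and g: "[:int p:] dvd P - g * R0" and gu: "\<not> int p dvd poly g u"
    and "[:int p:] dvd P - [:-u, 1:] ^ l * R1"
  shows "\<exists>R. [:int p:] dvd P - g * [:-u, 1:] ^ l * R"
  using assms(4)
proof (induction l arbitrary: R1)
  case 0
  then show ?case using g by auto
next
  case (Suc l)
  have pe: "prime_elem [:int p:]" using p by (simp add: prime_elem_const_poly_iff)
  have "[:int p:] dvd P - [:-u, 1:] ^ l * ([:-u, 1:] * R1)"
    using Suc.prems by (simp add: algebra_simps)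
  from Suc.IH[OF this] obtain R where R: "[:int p:] dvd P - g * [:-u, 1:] ^ l * R" by auto
  \<comment> \<open>Both representations of \<open>P\<close> share the factor
    \<open>[:-u, 1:] ^ l\<close>. Subtracting and cancelling it, then evaluating at
    \<open>u\<close>, shows that \<open>p\<close> divides \<open>poly R u\<close>, so
    \<open>R\<close> yields one more linear factor.\<close>
  have "[:int p:] dvd (P - [:-u, 1:] ^ Suc l * R1) - (P - g * [:-u, 1:] ^ l * R)"
    by (rule dvd_diff[OF Suc.prems R])
  also have "\<dots> = [:-u, 1:] ^ l * (g * R - [:-u, 1:] * R1)" by (simp add: algebra_simps)
  finally have "[:int p:] dvd [:-u, 1:] ^ l * (g * R - [:-u, 1:] * R1)" .
  moreover have "\<not> [:int p:] dvd [:-u, 1:] ^ l"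
    using p by (intro const_poly_not_dvd_monic) (auto simp: lead_coeff_power dest: prime_gt_1_nat)
  ultimately have "[:int p:] dvd g * R - [:-u, 1:] * R1"
    using pe by (simp add: prime_elem_dvd_mult_iff)
  from const_poly_dvd_poly[OF this, of u] have "int p dvd poly g u * poly R u" by simp
  then have "int p dvd poly R u" using gu p by (simp add: prime_dvd_mult_iff)
  then have "[:int p:] dvd [:poly R u:]" by simp
  moreover obtain R' where R': "R = [:-u, 1:] * R' + [:poly R u:]"
    by (metis synthetic_div_correct')
  ultimately obtain S where S: "R = [:-u, 1:] * R' + [:int p:] * S" by (metis dvdE)
  have "P - g * [:-u, 1:] ^ Suc l * R' = (P - g * [:-u, 1:] ^ l * R) + [:int p:] * (g * [:-u, 1:] ^ l * S)"
    by (subst S) (simp add: algebra_simps)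
  then have "[:int p:] dvd P - g * [:-u, 1:] ^ Suc l * R'"
    using R by (metis dvd_add dvd_triv_left)
  then show ?case by auto
qed

text \<open>With the coefficients of the quotient reduced modulo \<open>p\<close>, its leading
  coefficient is a nonzero residue. As \<open>g\<close> is monic, this coefficient survives in the
  product and must be matched by a nonzero coefficient of \<open>P\<close>.\<close>

lemma degree_le_of_monic_dvd_mod_prime:
  fixes p :: nat and P g :: "int poly"
  assumes dvd: "[:int p:] dvd P - g * R" and g: "lead_coeff g = 1"
    and P: "\<not> [:int p:] dvd P"
  shows "degree g \<le> degree P"
proof -
  define R' where "R' = map_poly (\<lambda>c. c mod int p) R"
  have "[:int p:] dvd R - R'"
    by (auto simp: R'_def const_poly_dvd_iff coeff_map_poly)
  then have "[:int p:] dvd (P - g * R) + g * (R - R')"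
    using dvd by (intro dvd_add dvd_mult)
  then have d: "[:int p:] dvd P - g * R'" by (simp add: algebra_simps)
  have "R' \<noteq> 0" using d P by auto
  then have "lead_coeff R' \<noteq> 0" by simp
  moreover have "lead_coeff R' = lead_coeff R' mod int p"
    by (simp add: R'_def coeff_map_poly)
  ultimately have "\<not> int p dvd lead_coeff R'"
    by (metis mod_eq_0_iff_dvd)
  moreover have "int p dvd coeff P (degree g + degree R') - lead_coeff R'"
  proof -
    have "int p dvd coeff (P - g * R') (degree g + degree R')"
      using d by (simp add: const_poly_dvd_iff)
    then show ?thesis using g by (simp add: coeff_mult_degree_sum)
  qed
  ultimately have "coeff P (degree g + degree R') \<noteq> 0" by auto
  then have "degree g + degree R' \<le> degree P" by (rule le_degree)
  then show ?thesis by simp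
qed

text \<open>Distinct elements of \<open>{0..<int p}\<close> are incongruent, so the factors
  \<open>[:-u, 1:] ^ l\<close> can be collected one point at a time into a single monic divisor of
  \<open>P\<close> modulo \<open>p\<close>, of degree \<open>l * card U\<close>.\<close>

lemma card_mult_roots_mod_prime_le_degree:
  fixes p :: nat and P :: "int poly" and U :: "int set"
  assumes p: "prime p" and l: "l \<le> p" and P: "\<not> [:int p:] dvd P"
    and U: "U \<subseteq> {0..<int p}"
    and der: "\<And>u k. u \<in> U \<Longrightarrow> k < l \<Longrightarrow> int p dvd poly ((pderiv ^^ k) P) u"
  shows "l * card U \<le> degree P"
proof -
  define g where "g V = (\<Prod>u\<in>V. [:-u, 1:] ^ l)" for V :: "int set"
  have finU: "finite U" using U finite_subset by blast
  have "\<exists>R. [:int p:] dvd P - g V * R" if "finite V" "V \<subseteq> U" for V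
    using that
  proof (induction V)
    case empty
    then show ?case by (auto simp: g_def intro: exI[of _ P])
  next
    case (insert u V)
    then obtain R0 where R0: "[:int p:] dvd P - g V * R0" by auto
    obtain R1 where R1: "[:int p:] dvd P - [:-u, 1:] ^ l * R1"
      using linear_power_dvd_mod_prime[OF p l der] insert.prems by blast
    have "\<not> int p dvd poly (g V) u"
    proof
      assume "int p dvd poly (g V) u"
      then have "int p dvd (\<Prod>v\<in>V. (u - v) ^ l)" by (simp add: g_def poly_prod)
      then obtain v where v: "v \<in> V" "int p dvd (u - v) ^ l"
        using p insert.hyps(1) by (subst (asm) prime_dvd_prod_iff) auto
      then have dvd: "int p dvd u - v" using p prime_dvd_power by (metis prime_nat_int_transfer)
      have "u \<in> {0..<int p}" "v \<in> {0..<int p}" using v insert.prems U by auto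
      then have "\<bar>u - v\<bar> < int p" by auto
      then have "u = v" using dvd_imp_le_int[OF _ dvd] by (cases "u = v") auto
      then show False using v insert.hyps by simp
    qed
    from mult_linear_power_dvd_mod_prime[OF p R0 this R1]
    show ?case using insert.hyps by (simp add: g_def mult.commute)
  qed
  then obtain R where "[:int p:] dvd P - g U * R" using finU by blast
  moreover have "lead_coeff (g U) = 1"
    by (simp add: g_def lead_coeff_prod lead_coeff_power)
  moreover have "degree (g U) = l * card U"
    by (simp add: g_def degree_prod_eq_sum_degree degree_power_eq)
  ultimately show ?thesis using degree_le_of_monic_dvd_mod_prime[OF _ _ P] by metis
qed

section \<open>Stepanov's method\<close>

text \<open>Pigeonhole: \<open>p ^ card W\<close> coefficient vectors have at most
  \<open>p ^ card I\<close> images, so two of them collide, and their difference solves the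
  homogeneous system.\<close>

lemma exists_nontrivial_solution_mod:
  fixes A :: "'i \<Rightarrow> 'w \<Rightarrow> int" and p :: nat
  assumes "finite I" "finite W" "card I < card W" "p > 1"
  obtains v where "\<exists>w\<in>W. \<not> int p dvd v w"
    and "\<And>i. i \<in> I \<Longrightarrow> int p dvd (\<Sum>w\<in>W. v w * A i w)"
proof -
  define F where "F v = restrict (\<lambda>i. (\<Sum>w\<in>W. v w * A i w) mod int p) I" for v
  define S where "S = PiE W (\<lambda>_. {0..<int p})"
  have "F ` S \<subseteq> PiE I (\<lambda>_. {0..<int p})"
    using assms(4) by (auto simp: F_def PiE_def Pi_def)
  then have "card (F ` S) \<le> card (PiE I (\<lambda>_. {0..<int p}))"
    using assms by (intro card_mono finite_PiE) auto
  also have "\<dots> = p ^ card I" using assms(1) by (simp add: card_PiE)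
  also have "\<dots> < p ^ card W" using assms by (simp add: power_strict_increasing)
  also have "\<dots> = card S" using assms(2) by (simp add: S_def card_PiE)
  finally have "\<not> inj_on F S" by (rule pigeonhole)
  then obtain v v' where v: "v \<in> S" "v' \<in> S" "F v = F v'" "v \<noteq> v'" by (auto simp: inj_on_def)
  have "\<exists>w\<in>W. v w \<noteq> v' w" using v by (metis PiE_ext S_def)
  then obtain w where w: "w \<in> W" "v w \<noteq> v' w" by blast
  have r: "v w \<in> {0..<int p}" "v' w \<in> {0..<int p}" using v w by (auto simp: S_def)
  have "\<not> int p dvd v w - v' w"
  proof
    assume "int p dvd v w - v' w"
    then have "int p \<le> \<bar>v w - v' w\<bar>" using w dvd_imp_le_int[of "v w - v' w" "int p"] by simp
    then show False using r by auto
  qed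
  then have 1: "\<exists>w\<in>W. \<not> int p dvd (\<lambda>w. v w - v' w) w" using w by blast
  have 2: "int p dvd (\<Sum>w\<in>W. (\<lambda>w. v w - v' w) w * A i w)" if "i \<in> I" for i
  proof -
    have "(\<Sum>w\<in>W. v w * A i w) mod int p = (\<Sum>w\<in>W. v' w * A i w) mod int p"
      using fun_cong[OF v(3), of i] that by (simp add: F_def)
    then show ?thesis by (simp add: mod_eq_dvd_iff left_diff_distrib sum_subtractf)
  qed
  from 1 2 show ?thesis by (rule that)
qed

text \<open>Among the terms with \<open>v w\<close> nonzero modulo \<open>p\<close>, the one of
  least order at 0 cannot be cancelled, because no other term has the same order.\<close>

lemma const_not_dvd_sum_distinct_orders:
  fixes p :: nat and G :: "'w \<Rightarrow> int poly"
  assumes p: "prime p" and W: "finite W" "inj_on e W"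
    and v: "\<exists>w\<in>W. \<not> int p dvd v w"
    and G: "\<And>w. w \<in> W \<Longrightarrow> \<not> int p dvd coeff (G w) 0"
  shows "\<not> [:int p:] dvd (\<Sum>w\<in>W. smult (v w) (monom 1 (e w) * G w))"
proof
  assume dvd: "[:int p:] dvd (\<Sum>w\<in>W. smult (v w) (monom 1 (e w) * G w))"
  obtain w0 where w0: "w0 \<in> W" "\<not> int p dvd v w0"
    and min: "\<And>w. w \<in> W \<Longrightarrow> \<not> int p dvd v w \<Longrightarrow> e w0 \<le> (e w :: nat)"
    using v ex_has_least_nat[of "\<lambda>w. w \<in> W \<and> \<not> int p dvd v w" _ e] by blast
  define t where "t w = coeff (smult (v w) (monom 1 (e w) * G w)) (e w0)" for w
  have "int p dvd coeff (\<Sum>w\<in>W. smult (v w) (monom 1 (e w) * G w)) (e w0)"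
    using dvd by (simp add: const_poly_dvd_iff)
  also have "\<dots> = t w0 + (\<Sum>w\<in>W - {w0}. t w)"
    using W w0 by (simp add: coeff_sum t_def sum.remove)
  finally have "int p dvd t w0 + (\<Sum>w\<in>W - {w0}. t w)" .
  moreover have "int p dvd (\<Sum>w\<in>W - {w0}. t w)"
  proof (rule dvd_sum)
    fix w assume w: "w \<in> W - {w0}"
    then have "e w \<noteq> e w0" using W w0 by (auto dest: inj_onD)
    then show "int p dvd t w"
      using min[of w] w by (cases "int p dvd v w") (auto simp: t_def coeff_monom_mult)
  qed
  ultimately have "int p dvd t w0" by (simp add: dvd_add_left_iff)
  then have "int p dvd v w0 * coeff (G w0) 0" by (simp add: t_def coeff_monom_mult)
  then show False using w0 G p by (simp add: prime_dvd_mult_iff)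
qed

text \<open>The factor left in the \<open>k\<close>-th derivative of \<open>f ^ a * q\<close> once
  \<open>f ^ (a - k)\<close> is taken out. The recursion is the product rule, and its degree grows
  by at most \<open>degree f\<close> per step, independently of the large exponent
  \<open>a\<close>.\<close>

primrec deriv_cofactor :: "'a::idom poly \<Rightarrow> nat \<Rightarrow> 'a poly \<Rightarrow> nat \<Rightarrow> 'a poly" where
  "deriv_cofactor f a q 0 = q"
| "deriv_cofactor f a q (Suc k) =
     smult (of_nat (a - k)) (pderiv f * deriv_cofactor f a q k) + f * pderiv (deriv_cofactor f a q k)"

lemma higher_pderiv_power_mult:
  "k \<le> a \<Longrightarrow> (pderiv ^^ k) (f ^ a * q) = f ^ (a - k) * deriv_cofactor f a q k"
proof (induction k)
  case (Suc k)
  then obtain b where b: "a - k = Suc b" "a - Suc k = b" by (metis Suc_diff_Suc Suc_le_lessD)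
  with Suc show ?case
    by (simp add: pderiv_mult pderiv_power_Suc Suc_diff_Suc algebra_simps del: power_Suc)
      (simp add: algebra_simps)
qed simp

lemma degree_deriv_cofactor_le:
  "degree (deriv_cofactor f a q k) \<le> degree q + k * degree f" for f :: "'a::{idom,semiring_char_0} poly"
proof (induction k)
  case (Suc k)
  have "degree (pderiv f * deriv_cofactor f a q k) \<le> degree f + (degree q + k * degree f)"
    by (rule order.trans[OF degree_mult_le]) (use Suc degree_pderiv[of f] in simp)
  moreover have "degree (f * pderiv (deriv_cofactor f a q k)) \<le> degree f + (degree q + k * degree f)"
    by (rule order.trans[OF degree_mult_le]) (use Suc degree_pderiv[of "deriv_cofactor f a q k"] in simp)
  ultimately show ?case
    by (auto intro!: degree_add_le order.trans[OF degree_smult_le] simp: algebra_simps)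
qed simp

text \<open>The derivative of \<open>monom 1 (j * p)\<close> carries the factor \<open>p\<close>, so
  this monomial behaves like a constant under differentiation modulo \<open>p\<close>.\<close>

lemma higher_pderiv_mult_monom_cong:
  fixes p :: nat and Q :: "int poly"
  shows "[:int p:] dvd (pderiv ^^ k) (Q * monom 1 (j * p)) - (pderiv ^^ k) Q * monom 1 (j * p)"
proof (induction k)
  case (Suc k)
  let ?M = "monom 1 (j * p) :: int poly"
  have M: "[:int p:] dvd pderiv ?M"
    by (auto simp: pderiv_monom const_poly_dvd_iff)
  have "pderiv ((pderiv ^^ k) (Q * ?M)) - pderiv ((pderiv ^^ k) Q) * ?M
      = pderiv ((pderiv ^^ k) (Q * ?M) - (pderiv ^^ k) Q * ?M) + (pderiv ^^ k) Q * pderiv ?M"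
    by (simp add: pderiv_diff pderiv_mult algebra_simps)
  then show ?case
    using const_poly_dvd_pderiv[OF Suc] M by simp
qed simp

lemma fermat_little_int:
  fixes u :: int
  assumes p: "prime p"
  shows "[u ^ p = u] (mod int p)"
proof (cases "int p dvd u")
  case True
  then have "int p dvd u ^ p" using p by (meson dvd_trans dvd_power_same dvd_power prime_gt_0_nat)
  then show ?thesis using True by (meson cong_0_iff cong_sym cong_trans)
next
  case False
  define a where "a = nat (u mod int p)"
  have a: "int a = u mod int p" using p by (simp add: a_def prime_gt_0_nat)
  have "\<not> p dvd a" using False a by (metis dvd_mod_iff dvd_refl of_nat_dvd_iff)
  then have "[a ^ (p - 1) = 1] (mod p)" by (rule fermat_theorem[OF p])
  then have "[int a ^ (p - 1) = 1] (mod int p)" by (metis cong_int_iff of_nat_1 of_nat_power)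
  then have "[u ^ (p - 1) = 1] (mod int p)" unfolding a by (simp add: Cong.cong_def power_mod)
  then have "[u * u ^ (p - 1) = u * 1] (mod int p)" by (rule cong_scalar_left)
  then show ?thesis using p by (simp add: power_eq_if[of u p] prime_gt_0_nat)
qed

text \<open>The auxiliary polynomial is
  \<open>P = f\<^sup>l \<Sum> v(j,t,i) f\<^sup>t\<^sup>h x\<^sup>j\<^sup>p\<^sup>+\<^sup>i\<close> over \<open>j < D\<close>, \<open>t < 2\<close>, \<open>i < h\<close>. At a point \<open>u\<close> with
  \<open>f(u)\<^sup>h = \<eta>\<close> the vanishing of its \<open>k\<close>-th derivative reduces, via \<open>u\<^sup>p = u\<close>, to that of a
  polynomial of low degree, and \<open>P\<close> is nonzero modulo \<open>p\<close> because \<open>f = x g\<close> has a simple root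
  at \<open>0\<close>, so that its terms have the distinct orders \<open>j p + t h + i\<close> there.\<close>

lemma stepanov_bound:
  fixes p h m D :: nat and g :: "int poly" and \<eta> :: int and U :: "int set"
  defines "f \<equiv> [:0, 1:] * g"
  assumes p: "prime p" "p = 2 * h + 1" and g: "lead_coeff g = 1" "\<not> int p dvd coeff g 0"
    and m: "degree f = m"
    and D: "D > 0" "4 * (m + 1) * D\<^sup>2 \<le> h"
    and U: "U \<subseteq> {0..<int p}" "\<And>u. u \<in> U \<Longrightarrow> [poly f u ^ h = \<eta>] (mod int p)"
  shows "(2 * D - 1) * card U \<le> (2 * D - 1) * m + h * (m + 1) + (D - 1) * p"
proof -
  \<comment> \<open>The order of vanishing forced at each point of \<open>U\<close>. There are
    \<open>2 * D * h\<close> unknown coefficients and slightly more than \<open>h\<close> conditions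
    per derivative, which leaves room for \<open>2 * D - 1\<close> derivatives.\<close>
  define l where "l = 2 * D - 1"
  \<comment> \<open>Exceeds the degree of every \<open>B k w\<close> with \<open>w \<in> W\<close>
    and \<open>k < l\<close>, so \<open>M\<close> coefficient conditions per derivative
    suffice.\<close>
  define M where "M = h + l * m + D"
  define W :: "(nat \<times> nat \<times> nat) set" where "W = {..<D} \<times> {..<2} \<times> {..<h}"
  define cof where "cof t i k = deriv_cofactor f (l + t * h) (monom 1 i) k" for t i k
  \<comment> \<open>What remains of the \<open>k\<close>-th derivative of \<open>T w\<close> at a
    point \<open>u\<close> of \<open>U\<close> after removing \<open>f(u)\<close> to the power
    \<open>l - k\<close> and replacing \<open>f(u)^h\<close> by \<open>\<eta>\<close> and
    \<open>u^(j p)\<close> by \<open>u^j\<close>. It no longer depends on \<open>u\<close>.\<close>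
  define B where "B k = (\<lambda>(j, t, i). smult (\<eta> ^ t) (cof t i k * monom 1 j))" for k :: nat
  define e where "e = (\<lambda>(j, t, i). j * p + t * h + i)"
  define G where "G = (\<lambda>(j::nat, t, i::nat). g ^ (t * h))"
  define T where "T = (\<lambda>(j, t, i). f ^ (l + t * h) * monom 1 i * monom 1 (j * p))"
  \<comment> \<open>The excess of \<open>l * M\<close> over \<open>l * h\<close> is
    \<open>l * (l * m + D)\<close>. Keeping it below \<open>h\<close> gives fewer than
    \<open>(l + 1) * h = 2 * D * h\<close> conditions.\<close>
  have "l * (l * m + D) < 2 * D * (2 * D * (m + 1))"
  proof (intro mult_less_le_imp_less)
    have "l * m + D \<le> 2 * D * m + 2 * D" by (intro add_mono mult_right_mono) (auto simp: l_def)
    then show "l * m + D \<le> 2 * D * (m + 1)" by (simp add: algebra_simps)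
  qed (use D(1) in \<open>auto simp: l_def\<close>)
  then have lp: "l * (l * m + D) < h"
    using D(2) by (simp add: power2_eq_square algebra_simps)
  have "l * 1 \<le> l * (l * m + D)" using D(1) by (intro mult_le_mono2) simp
  then have l_le: "l \<le> p" using lp p(2) by linarith
  have finW: "finite W" by (simp add: W_def)
  have "card ({..<l} \<times> {..<M}) < card W"
  proof -
    have "l * M < 2 * D * h"
    proof -
      have "l * M = l * h + l * (l * m + D)" by (simp add: M_def algebra_simps)
      also have "\<dots> < (l + 1) * h" using lp by simp
      also have "l + 1 = 2 * D" using D(1) by (simp add: l_def)
      finally show ?thesis .
    qed
    then show ?thesis by (simp add: W_def)
  qed
  then obtain v where v: "\<exists>w\<in>W. \<not> int p dvd v w"
    and sol: "\<And>z. z \<in> {..<l} \<times> {..<M} \<Longrightarrow> int p dvd (\<Sum>w\<in>W. v w * (\<lambda>(k, n). coeff (B k w) n) z)"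
    using exists_nontrivial_solution_mod[of "{..<l} \<times> {..<M}" W p "\<lambda>(k, n) w. coeff (B k w) n"]
      finW p prime_gt_1_nat[OF p(1)]
    by (auto simp: case_prod_beta)
  define P where "P = (\<Sum>w\<in>W. smult (v w) (T w))"
  have "\<not> [:int p:] dvd P"
  proof -
    have "T w = f ^ l * (monom 1 (e w) * G w)" for w
    proof -
      obtain j t i where w: "w = (j, t, i)" by (cases w)
      have "f ^ (t * h) = monom 1 (t * h) * g ^ (t * h)"
        by (simp only: f_def power_mult_distrib monom_altdef smult_1_left)
      moreover have "monom 1 (a + b) = monom 1 a * (monom 1 b :: int poly)" for a b
        by (simp add: mult_monom)
      ultimately show ?thesis
        by (simp only: w T_def e_def G_def prod.case power_add mult_ac)
    qed
    then have "P = f ^ l * (\<Sum>w\<in>W. smult (v w) (monom 1 (e w) * G w))"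
      by (simp add: P_def sum_distrib_left)
    moreover have "\<not> [:int p:] dvd f ^ l"
      using p g by (intro const_poly_not_dvd_monic)
        (auto simp: f_def lead_coeff_power lead_coeff_mult dest: prime_gt_1_nat)
    moreover have "\<not> [:int p:] dvd (\<Sum>w\<in>W. smult (v w) (monom 1 (e w) * G w))"
    proof (rule const_not_dvd_sum_distinct_orders[OF p(1) finW _ v])
      show "inj_on e W"
      proof (rule inj_on_inverseI)
        fix w assume "w \<in> W"
        then obtain j t i where w: "w = (j, t, i)" and r: "t < 2" "i < h" by (auto simp: W_def)
        \<comment> \<open>Since \<open>t * h + i < 2 * h < p\<close>, the triple is recovered from
          \<open>e w\<close> by division by \<open>p\<close> and then by \<open>h\<close>.\<close>
        have "t * h \<le> 1 * h" using r by (intro mult_right_mono) auto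
        then have "t * h + i < p" using r p(2) by linarith
        then have "e w div p = j" "e w mod p = t * h + i" by (simp_all add: e_def w add.assoc)
        then show "(\<lambda>x. (x div p, x mod p div h, x mod p mod h)) (e w) = w"
          using r by (simp add: w)
      qed
      show "\<not> int p dvd coeff (G w) 0" if "w \<in> W" for w
        using g(2) p(1) prime_dvd_power[of "int p" "coeff g 0"]
        by (auto simp: G_def coeff_0_power split: prod.splits)
    qed
    ultimately show ?thesis using p(1) by (simp add: prime_elem_dvd_mult_iff prime_elem_const_poly_iff)
  qed
  moreover have "int p dvd poly ((pderiv ^^ k) P) u" if u: "u \<in> U" and k: "k < l" for u k
  proof -
    \<comment> \<open>The coefficients below \<open>M\<close> vanish modulo \<open>p\<close> by the
      choice of \<open>v\<close>, those from \<open>M\<close> on by degree.\<close>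
    have "[:int p:] dvd (\<Sum>w\<in>W. smult (v w) (B k w))"
      unfolding const_poly_dvd_iff
    proof
      fix n
      show "int p dvd coeff (\<Sum>w\<in>W. smult (v w) (B k w)) n"
      proof (cases "n < M")
        case True
        then show ?thesis using sol[of "(k, n)"] k by (simp add: coeff_sum)
      next
        case False
        have "coeff (B k w) n = 0" if "w \<in> W" for w
        proof -
          obtain j t i where w: "w = (j, t, i)" by (cases w)
          have ji: "j < D" "i < h" using that by (auto simp: w W_def)
          have "degree (B k w) \<le> degree (cof t i k) + j"
            by (auto simp: B_def w intro!: order.trans[OF degree_smult_le] order.trans[OF degree_mult_le] degree_monom_le)
          also have "degree (cof t i k) \<le> i + k * m"
            using degree_deriv_cofactor_le[of f "l + t * h" "monom 1 i" k]
            by (simp add: cof_def m degree_monom_eq)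
          also have "i + k * m + j < n"
            using False ji mult_le_mono1[of k l m] k unfolding M_def by linarith
          finally show ?thesis by (simp add: coeff_eq_0)
        qed
        then show ?thesis by (simp add: coeff_sum)
      qed
    qed
    then have "int p dvd poly (\<Sum>w\<in>W. smult (v w) (B k w)) u" by (rule const_poly_dvd_poly)
    then have "int p dvd poly f u ^ (l - k) * poly (\<Sum>w\<in>W. smult (v w) (B k w)) u" by simp
    moreover have "[poly ((pderiv ^^ k) P) u = poly f u ^ (l - k) * poly (\<Sum>w\<in>W. smult (v w) (B k w)) u] (mod int p)"
    proof -
      have "[poly ((pderiv ^^ k) (T w)) u = poly f u ^ (l - k) * poly (B k w) u] (mod int p)" for w
      proof -
        obtain j t i where w: "w = (j, t, i)" by (cases w)
        have "int p dvd poly ((pderiv ^^ k) (T w) - (pderiv ^^ k) (f ^ (l + t * h) * monom 1 i) * monom 1 (j * p)) u"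
          by (rule const_poly_dvd_poly) (simp only: T_def w prod.case higher_pderiv_mult_monom_cong)
        then have "[poly ((pderiv ^^ k) (T w)) u = poly ((pderiv ^^ k) (f ^ (l + t * h) * monom 1 i)) u * u ^ (j * p)] (mod int p)"
          by (simp add: cong_iff_dvd_diff poly_monom)
        also have "poly ((pderiv ^^ k) (f ^ (l + t * h) * monom 1 i)) u
            = poly f u ^ (l - k) * (poly f u ^ h) ^ t * poly (cof t i k) u"
        proof -
          have "(pderiv ^^ k) (f ^ (l + t * h) * monom 1 i) = f ^ (l + t * h - k) * cof t i k"
            unfolding cof_def using k by (intro higher_pderiv_power_mult) simp
          moreover have "l + t * h - k = l - k + h * t" using k by (simp add: mult.commute)
          ultimately show ?thesis by (simp only: poly_mult poly_power power_add power_mult)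
        qed
        also have "[\<dots> * u ^ (j * p) = poly f u ^ (l - k) * \<eta> ^ t * poly (cof t i k) u * u ^ j] (mod int p)"
        proof -
          have "[u ^ (j * p) = u ^ j] (mod int p)"
            using cong_pow[OF fermat_little_int[OF p(1), of u], of j] by (simp add: power_mult[symmetric] mult.commute)
          then show ?thesis using U(2)[OF u] by (intro cong_mult cong_pow cong_refl)
        qed
        finally show ?thesis by (simp add: B_def w poly_monom mult_ac)
      qed
      then show ?thesis
        unfolding P_def higher_pderiv_sum higher_pderiv_smult poly_sum sum_distrib_left
        by (intro cong_sum) (simp add: cong_scalar_left mult.left_commute)
    qed
    ultimately show ?thesis by (simp add: cong_dvd_iff)
  qed
  ultimately have "l * card U \<le> degree P"
    using card_mult_roots_mod_prime_le_degree[OF p(1) l_le _ U(1)] by blast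
  also have "degree P \<le> l * m + h * (m + 1) + (D - 1) * p"
    unfolding P_def
  proof (rule degree_sum_le[OF finW])
    fix w assume "w \<in> W"
    then obtain j t i where w: "w = (j, t, i)" and r: "j < D" "t < 2" "i < h" by (auto simp: W_def)
    have "degree (smult (v w) (T w)) \<le> (l + t * h) * m + i + j * p"
      unfolding w T_def prod.case
      by (intro order.trans[OF degree_smult_le] order.trans[OF degree_mult_le] add_mono degree_monom_le)
        (use degree_power_le[of f "l + t * h"] m in \<open>simp add: mult.commute\<close>)
    also have "\<dots> \<le> l * m + h * (m + 1) + (D - 1) * p"
    proof -
      have "t * h * m \<le> 1 * h * m" "j * p \<le> (D - 1) * p" using r by (auto intro!: mult_right_mono)
      moreover have "(l + t * h) * m = l * m + t * h * m" "h * (m + 1) = 1 * h * m + h"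
        by (simp_all add: algebra_simps)
      ultimately show ?thesis using r by linarith
    qed
    finally show "degree (smult (v w) (T w)) \<le> \<dots>" .
  qed
  finally show ?thesis by (simp add: l_def)
qed

section \<open>Character sums\<close>

lemma Legendre_cong: "[a = b] (mod p) \<Longrightarrow> Legendre a p = Legendre b p"
  by (simp add: Legendre_def QuadRes_def Cong.cong_def)

lemma Legendre_values: "Legendre a p \<in> {-1, 0, 1}"
  by (simp add: Legendre_def)

lemma Legendre_eq_0_iff: "Legendre a p = 0 \<longleftrightarrow> p dvd a"
  by (simp add: Legendre_def cong_0_iff)

lemma cong_poly: "[x = y] (mod n) \<Longrightarrow> [poly P x = poly P y] (mod n)" for x :: int
  by (induction P) (auto intro: cong_add cong_mult)

lemma eq_if_cong_of_small_abs:
  fixes a b :: int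
  assumes "[a = b] (mod p)" "\<bar>a - b\<bar> < p"
  shows "a = b"
proof -
  have "p dvd a - b" using assms(1) by (simp add: cong_iff_dvd_diff)
  then show ?thesis using assms(2) dvd_imp_le_int[of "a - b" p] by (cases "a = b") auto
qed

text \<open>Euler's criterion gives the congruence modulo \<open>p\<close>. Both sides lie between
  -1 and 1, so they differ by at most 2, which is less than \<open>p\<close>.\<close>

lemma Legendre_mult:
  fixes p :: nat
  assumes "prime p" "2 < p"
  shows "Legendre (a * b) p = Legendre a p * Legendre b p"
proof (rule eq_if_cong_of_small_abs)
  let ?h = "(p - 1) div 2"
  have "[Legendre (a * b) p = (a * b) ^ ?h] (mod int p)" by (rule euler_criterion[OF assms])
  also have "(a * b) ^ ?h = a ^ ?h * b ^ ?h" by (rule power_mult_distrib)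
  also have "[\<dots> = Legendre a p * Legendre b p] (mod int p)"
    by (intro cong_mult cong_sym[OF euler_criterion[OF assms]])
  finally show "[Legendre (a * b) p = Legendre a p * Legendre b p] (mod int p)" .
  show "\<bar>Legendre (a * b) (int p) - Legendre a (int p) * Legendre b (int p)\<bar> < int p"
  proof -
    have v: "\<bar>Legendre x (int p)\<bar> \<le> 1" for x by (simp add: Legendre_def)
    have "\<bar>Legendre a (int p) * Legendre b (int p)\<bar> \<le> 1 * 1"
      unfolding abs_mult by (intro mult_mono v) auto
    then show ?thesis using v[of "a * b"] assms(2) by linarith
  qed
qed

lemma Legendre_1: "prime p \<Longrightarrow> Legendre 1 (int p) = 1"
proof -
  assume "prime p"
  then have "\<not> int p dvd 1" using prime_gt_1_nat by auto
  moreover have "QuadRes (int p) 1" unfolding QuadRes_def by (rule exI[of _ 1]) simp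
  ultimately show ?thesis by (simp add: Legendre_def cong_0_iff)
qed

lemma Legendre_prod:
  fixes p :: nat
  assumes "prime p" "2 < p"
  shows "Legendre (\<Prod>a\<in>A. g a) p = (\<Prod>a\<in>A. Legendre (g a) p)"
  by (induction A rule: infinite_finite_induct)
    (simp_all add: Legendre_mult[OF assms] Legendre_1[OF assms(1)])

lemma sum_residues_shift:
  fixes p :: nat and F :: "int \<Rightarrow> int"
  assumes "p > 0" and F: "\<And>x y. [x = y] (mod int p) \<Longrightarrow> F x = F y"
  shows "(\<Sum>x\<in>{0..<int p}. F (x + a)) = (\<Sum>x\<in>{0..<int p}. F x)"
proof (rule sum.reindex_bij_witness[where i = "\<lambda>x. (x - a) mod int p" and j = "\<lambda>x. (x + a) mod int p"])
  fix x assume x: "x \<in> {0..<int p}"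
  show "((x + a) mod int p - a) mod int p = x" "((x - a) mod int p + a) mod int p = x"
    using x by (simp_all add: mod_diff_left_eq mod_add_left_eq)
  show "(x + a) mod int p \<in> {0..<int p}" "(x - a) mod int p \<in> {0..<int p}"
    using assms(1) by simp_all
  show "F ((x + a) mod int p) = F (x + a)" by (intro F) simp
qed

text \<open>Stepanov's bound limits from above how often each of the values 1 and -1 is taken. Since
  the two counts add up to \<open>p\<close> minus at most \<open>m\<close> zeros, upper bounds for
  both also bound their difference in absolute value.\<close>

lemma character_sum_bound_simple_root_0:
  fixes p m D :: nat and g :: "int poly"
  defines "f \<equiv> [:0, 1:] * g"
  assumes p: "prime p" "2 < p" and g: "lead_coeff g = 1" "\<not> int p dvd coeff g 0"
    and m: "degree f = m" and D: "D > 0" "8 * (m + 1) * D\<^sup>2 + 1 \<le> p"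
  shows "int D * \<bar>\<Sum>x\<in>{0..<int p}. Legendre (poly f x) p\<bar> \<le> int (p * m + 3 * m * D)"
proof -
  obtain h where h: "p = 2 * h + 1" using p prime_odd_nat by (metis oddE)
  have Dh: "4 * (m + 1) * D\<^sup>2 \<le> h"
  proof -
    have "2 * (4 * (m + 1) * D\<^sup>2) = 8 * (m + 1) * D\<^sup>2" by simp
    then show ?thesis using D(2) h by linarith
  qed
  define N where "N \<eta> = {x \<in> {0..<int p}. Legendre (poly f x) p = \<eta>}" for \<eta>
  have fin: "finite (N \<eta>)" for \<eta>
    by (rule finite_subset[of _ "{0..<int p}"]) (auto simp: N_def)
  have bound: "D * (2 * card (N \<eta>)) \<le> D * (2 * m + p) + p * m" if "\<eta> = 1 \<or> \<eta> = -1" for \<eta>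
  proof -
    have "(2 * D - 1) * card (N \<eta>) \<le> (2 * D - 1) * m + h * (m + 1) + (D - 1) * p"
    proof (rule stepanov_bound[OF p(1) h g m[unfolded f_def] D(1) Dh])
      fix x assume "x \<in> N \<eta>"
      then show "[poly ([:0, 1:] * g) x ^ h = \<eta>] (mod int p)"
        using euler_criterion[OF p, of "poly f x"] h by (simp add: N_def f_def cong_sym)
    qed (auto simp: N_def)
    then have "(2 * D - 1) * (2 * card (N \<eta>)) \<le> (2 * D - 1) * (2 * m) + 2 * h * (m + 1) + (2 * D - 2) * p"
      by (simp add: algebra_simps diff_mult_distrib2)
    also have "2 * h * (m + 1) \<le> p * (m + 1)" using h by (intro mult_right_mono) auto
    also have "(2 * D - 1) * (2 * m) + p * (m + 1) + (2 * D - 2) * p = (2 * D - 1) * (2 * m + p) + p * m"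
      using D(1) by (cases D) (auto simp: algebra_simps)
    finally have *: "(2 * D - 1) * (2 * card (N \<eta>)) \<le> (2 * D - 1) * (2 * m + p) + p * m" by simp
    \<comment> \<open>The weight \<open>2 * D - 1\<close> may be lowered to \<open>D\<close> only on
      a nonnegative excess over \<open>2 * m + p\<close>, hence the case distinction.\<close>
    show ?thesis
    proof (cases "2 * card (N \<eta>) \<le> 2 * m + p")
      case True
      then show ?thesis by (simp add: trans_le_add1)
    next
      case False
      then obtain z where z: "2 * card (N \<eta>) = 2 * m + p + z" by (metis le_add_diff_inverse nat_le_linear)
      then have "(2 * D - 1) * z \<le> p * m" using * by (simp add: distrib_left)
      moreover have "D * z \<le> (2 * D - 1) * z" using D(1) by (intro mult_right_mono) auto
      ultimately have "D * z \<le> p * m" by (rule order.trans[rotated])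
      then show ?thesis by (simp add: z distrib_left)
    qed
  qed
  have zero: "card (N 0) \<le> m"
  proof -
    have "1 * card (N 0) \<le> degree f"
    proof (rule card_mult_roots_mod_prime_le_degree[OF p(1)])
      show "\<not> [:int p:] dvd f"
        using p g by (intro const_poly_not_dvd_monic) (auto simp: f_def lead_coeff_mult)
    qed (use p in \<open>auto simp: N_def Legendre_eq_0_iff\<close>)
    then show ?thesis using m by simp
  qed
  have split: "(\<Sum>x\<in>{0..<int p}. F x) = (\<Sum>x\<in>N 1. F x) + (\<Sum>x\<in>N (-1). F x) + (\<Sum>x\<in>N 0. F x)"
    for F :: "int \<Rightarrow> int"
  proof -
    have "{0..<int p} = (N 1 \<union> N (-1)) \<union> N 0"
      using Legendre_values by (auto simp: N_def)
    also have "sum F \<dots> = sum F (N 1 \<union> N (-1)) + sum F (N 0)"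
      using fin by (intro sum.union_disjoint) (auto simp: N_def)
    also have "sum F (N 1 \<union> N (-1)) = sum F (N 1) + sum F (N (-1))"
      using fin by (intro sum.union_disjoint) (auto simp: N_def)
    finally show ?thesis .
  qed
  have S: "(\<Sum>x\<in>{0..<int p}. Legendre (poly f x) p) = int (card (N 1)) - int (card (N (-1)))"
    by (subst split) (simp add: N_def)
  have tot: "int p = int (card (N 1)) + int (card (N (-1))) + int (card (N 0))"
    using split[of "\<lambda>_. 1"] by simp
  have "int D * (2 * int (card (N \<eta>))) \<le> int D * (2 * int m + int p) + int (p * m)" if "\<eta> = 1 \<or> \<eta> = -1" for \<eta>
    using bound[OF that] by (metis (mono_tags, lifting) of_nat_add of_nat_le_iff of_nat_mult of_nat_numeral)
  from this[of 1] this[of "-1"]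
  have "int D * (2 * int (card (N 1)) - 2 * m - p) \<le> int (p * m)" "int D * (2 * int (card (N (-1))) - 2 * m - p) \<le> int (p * m)"
    by (simp_all add: algebra_simps)
  moreover have "int D * int (card (N 0)) \<le> int D * int m" using zero by (intro mult_left_mono) auto
  moreover have "int (card (N 1)) - int (card (N (-1))) = (2 * int (card (N 1)) - 2 * m - p) + int (card (N 0)) + 2 * m"
    "int (card (N (-1))) - int (card (N 1)) = (2 * int (card (N (-1))) - 2 * m - p) + int (card (N 0)) + 2 * m"
    using tot by linarith+
  moreover have "int (p * m + 3 * m * D) = int (p * m) + int D * int m + int D * (2 * int m)" by simp
  ultimately have "int D * (int (card (N 1)) - int (card (N (-1)))) \<le> int (p * m + 3 * m * D)"
    "int D * (int (card (N (-1))) - int (card (N 1))) \<le> int (p * m + 3 * m * D)"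
    by (simp_all only: distrib_left of_nat_mult of_nat_numeral)
  then have "int D * \<bar>int (card (N 1)) - int (card (N (-1)))\<bar> \<le> int (p * m + 3 * m * D)"
    by (cases "int (card (N 1)) \<le> int (card (N (-1)))") auto
  then show ?thesis unfolding S .
qed

text \<open>Translating the variable by some \<open>a0 \<in> A\<close> moves a root to 0. It is
  simple modulo \<open>p\<close> because the elements of \<open>A\<close> are distinct and at most
  \<open>m < p\<close>.\<close>

lemma character_sum_bound_shifts:
  fixes p m D :: nat and A :: "nat set"
  assumes p: "prime p" "2 < p" and A: "A \<subseteq> {1..m}" "A \<noteq> {}"
    and D: "D > 0" "8 * (m + 1) * D\<^sup>2 + 1 \<le> p"
  shows "int D * \<bar>\<Sum>x\<in>{0..<int p}. Legendre (\<Prod>a\<in>A. x + int a) p\<bar> \<le> int (p * m + 3 * m * D)"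
proof -
  have finA: "finite A" using A finite_subset by blast
  obtain a0 where a0: "a0 \<in> A" using A by blast
  define g where "g = (\<Prod>a\<in>A - {a0}. [:int a - int a0, 1:])"
  have f: "[:0, 1:] * g = (\<Prod>a\<in>A. [:int a - int a0, 1:])"
    using finA a0 by (simp add: g_def prod.remove[of A a0])
  have deg: "degree ([:0, 1:] * g) = card A"
    by (simp only: f) (simp add: degree_prod_eq_sum_degree)
  have cA: "card A \<le> m" using card_mono[of "{1..m}" A] A by simp
  have "m < 8 * (m + 1) * D\<^sup>2 + 1"
    using D(1) by (cases D) (auto simp: power2_eq_square)
  then have mp: "m < p" using D(2) by linarith
  have "int D * \<bar>\<Sum>x\<in>{0..<int p}. Legendre (poly ([:0, 1:] * g) x) p\<bar>
    \<le> int (p * card A + 3 * card A * D)"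
  proof (rule character_sum_bound_simple_root_0[OF p _ _ deg D(1)])
    show "lead_coeff g = 1" by (simp add: g_def lead_coeff_prod)
    show "\<not> int p dvd coeff g 0"
    proof
      assume "int p dvd coeff g 0"
      then have "int p dvd (\<Prod>a\<in>A - {a0}. int a - int a0)"
        by (simp add: g_def poly_0_coeff_0[symmetric] poly_prod)
      then obtain a where a: "a \<in> A - {a0}" "int p dvd int a - int a0"
        using p finA by (subst (asm) prime_dvd_prod_iff) auto
      have "a \<in> {1..m}" "a0 \<in> {1..m}" using a a0 A by auto
      then have "\<bar>int a - int a0\<bar> < int p" using mp by auto
      then show False using a dvd_imp_le_int[of "int a - int a0" "int p"] by auto
    qed
    have "8 * (card A + 1) * D\<^sup>2 \<le> 8 * (m + 1) * D\<^sup>2" using cA by (intro mult_right_mono) auto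
    then show "8 * (card A + 1) * D\<^sup>2 + 1 \<le> p" using D(2) by linarith
  qed
  also have "(\<Sum>x\<in>{0..<int p}. Legendre (poly ([:0, 1:] * g) x) p)
      = (\<Sum>x\<in>{0..<int p}. Legendre (poly ([:0, 1:] * g) (x + int a0)) p)"
    using p by (intro sum_residues_shift[symmetric] Legendre_cong cong_poly) auto
  also have "\<dots> = (\<Sum>x\<in>{0..<int p}. Legendre (\<Prod>a\<in>A. x + int a) p)"
    by (simp only: f poly_prod) (simp add: algebra_simps)
  also have "int (p * card A + 3 * card A * D) \<le> int (p * m + 3 * m * D)"
    using cA by (simp only: of_nat_le_iff) (intro add_mono mult_mono, auto)
  finally show ?thesis .
qed

text \<open>The product \<open>E x\<close> of the factors
  \<open>1 + \<eta> j * Legendre (x + j) p\<close> is \<open>2 ^ m\<close> on the set in question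
  and nonnegative elsewhere. Expanding it over subsets of \<open>{1..m}\<close>, the empty set
  contributes \<open>p\<close> and every other subset a bounded character sum.\<close>

lemma card_residues_with_character_pattern:
  fixes p m D :: nat and \<eta> :: "nat \<Rightarrow> int"
  assumes p: "prime p" "2 < p" and D: "D > 0" "8 * (m + 1) * D\<^sup>2 + 1 \<le> p"
    and \<eta>: "\<And>j. j \<in> {1..m} \<Longrightarrow> \<eta> j = 1 \<or> \<eta> j = -1"
  shows "D * 2 ^ m * card {x \<in> {0..<int p}. \<forall>j\<in>{1..m}. Legendre (x + int j) p = \<eta> j}
    \<le> D * p + 2 ^ m * (p * m + 3 * m * D)"
proof -
  define U where "U = {x \<in> {0..<int p}. \<forall>j\<in>{1..m}. Legendre (x + int j) p = \<eta> j}"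
  define E where "E x = (\<Prod>j\<in>{1..m}. \<eta> j * Legendre (x + int j) p + 1)" for x
  define T where "T A = (\<Sum>x\<in>{0..<int p}. Legendre (\<Prod>a\<in>A. x + int a) p)" for A :: "nat set"
  have E1: "E x = 2 ^ m" if "x \<in> U" for x
  proof -
    have "E x = (\<Prod>j\<in>{1..m}. 2)"
      unfolding E_def using that \<eta> by (intro prod.cong refl) (fastforce simp: U_def)
    then show ?thesis by simp
  qed
  have E0: "E x \<ge> 0" for x
    unfolding E_def
  proof (rule prod_nonneg)
    fix j assume "j \<in> {1..m}"
    then show "0 \<le> \<eta> j * Legendre (x + int j) p + 1"
      using \<eta>[of j] Legendre_values[of "x + int j" p] by auto
  qed
  have "2 ^ m * int (card U) = (\<Sum>x\<in>U. E x)" using E1 by simp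
  also have "\<dots> \<le> (\<Sum>x\<in>{0..<int p}. E x)"
    using E0 by (intro sum_mono2) (auto simp: U_def)
  also have "\<dots> = (\<Sum>A\<in>Pow {1..m}. (\<Prod>a\<in>A. \<eta> a) * T A)"
    unfolding E_def T_def
    by (simp add: prod_add prod.distrib Legendre_prod[OF p] sum_distrib_left) (rule sum.swap)
  also have "\<dots> = T {} + (\<Sum>A\<in>Pow {1..m} - {{}}. (\<Prod>a\<in>A. \<eta> a) * T A)"
    by (subst sum.remove[of _ "{}"]) auto
  also have "T {} = int p"
    using Legendre_prod[OF p, of id "{}"] by (simp add: T_def)
  finally have "int D * (2 ^ m * int (card U))
      \<le> int D * (int p + (\<Sum>A\<in>Pow {1..m} - {{}}. (\<Prod>a\<in>A. \<eta> a) * T A))"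
    by (intro mult_left_mono) auto
  also have "\<dots> = int D * int p + (\<Sum>A\<in>Pow {1..m} - {{}}. int D * ((\<Prod>a\<in>A. \<eta> a) * T A))"
    by (simp add: distrib_left sum_distrib_left)
  also have "(\<Sum>A\<in>Pow {1..m} - {{}}. int D * ((\<Prod>a\<in>A. \<eta> a) * T A))
      \<le> (\<Sum>A\<in>Pow {1..m} - {{}}. int (p * m + 3 * m * D))"
  proof (rule sum_mono)
    fix A assume A: "A \<in> Pow {1..m} - {{}}"
    have "\<bar>\<Prod>a\<in>A. \<eta> a\<bar> = (\<Prod>a\<in>A. 1)"
      unfolding abs_prod using A \<eta> by (intro prod.cong refl) fastforce
    then have "\<bar>(\<Prod>a\<in>A. \<eta> a) * T A\<bar> = \<bar>T A\<bar>" by (simp add: abs_mult)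
    then have "int D * ((\<Prod>a\<in>A. \<eta> a) * T A) \<le> int D * \<bar>T A\<bar>"
      by (intro mult_left_mono) auto
    also have "\<dots> \<le> int (p * m + 3 * m * D)"
      unfolding T_def using A by (intro character_sum_bound_shifts[OF p _ _ D]) auto
    finally show "int D * ((\<Prod>a\<in>A. \<eta> a) * T A) \<le> int (p * m + 3 * m * D)" .
  qed
  also have "\<dots> \<le> 2 ^ m * int (p * m + 3 * m * D)"
    by (auto simp: card_Diff_subset card_Pow intro!: mult_right_mono)
  finally have "int (D * 2 ^ m * card U) \<le> int (D * p + 2 ^ m * (p * m + 3 * m * D))"
    by (simp add: mult_ac)
  then show ?thesis by (simp only: of_nat_le_iff U_def)
qed

section \<open>Distinct products in the multiplication table\<close>

lemma harm_le_ln: "N \<ge> 1 \<Longrightarrow> harm N \<le> 1 + ln (real N)"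
  using decseqD[OF decseq_harm_diff_ln, of 0 "N - 1"] by (simp add: harm_expand)

text \<open>The lattice points under the hyperbola \<open>s * g = N\<close>. Their number is the
  summatory function of the divisor function, and two such points parametrise an equality of
  products in the multiplication table.\<close>

definition hyperbolic_pairs :: "nat \<Rightarrow> (nat \<times> nat) set" where
  "hyperbolic_pairs N = {(s, g). 1 \<le> s \<and> 1 \<le> g \<and> s * g \<le> N}"

lemma hyperbolic_pairs_eq: "hyperbolic_pairs N = (SIGMA s:{1..N}. {1..N div s})"
proof -
  have "1 \<le> s \<and> 1 \<le> g \<and> s * g \<le> N \<longleftrightarrow> s \<in> {1..N} \<and> g \<in> {1..N div s}" for s g
  proof (cases "1 \<le> s \<and> 1 \<le> g")
    case True
    then have "s * g \<le> N \<longleftrightarrow> g \<le> N div s"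
      by (simp add: less_eq_div_iff_mult_less_eq mult.commute)
    moreover have "s * 1 \<le> s * g" using True by (intro mult_le_mono2) simp
    then have "s * g \<le> N \<Longrightarrow> s \<le> N" by linarith
    ultimately show ?thesis using True by auto
  qed auto
  then show ?thesis by (simp add: hyperbolic_pairs_def Sigma_def set_eq_iff)
qed

lemma finite_hyperbolic_pairs: "finite (hyperbolic_pairs N)"
  by (simp add: hyperbolic_pairs_eq)

lemma card_hyperbolic_pairs_le:
  assumes "N \<ge> 1"
  shows "real (card (hyperbolic_pairs N)) \<le> real N * (1 + ln (real N))"
proof -
  have "real (card (hyperbolic_pairs N)) = (\<Sum>s\<in>{1..N}. real (N div s))"
    by (simp add: hyperbolic_pairs_eq)
  also have "\<dots> \<le> (\<Sum>s\<in>{1..N}. real N * inverse (real s))"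
    by (intro sum_mono) (use of_nat_div_le_of_nat in \<open>simp add: divide_inverse\<close>)
  also have "\<dots> = real N * harm N" by (simp add: harm_def sum_distrib_left)
  also have "\<dots> \<le> real N * (1 + ln (real N))"
    using harm_le_ln[OF assms] by (intro mult_left_mono) auto
  finally show ?thesis .
qed

definition mult_table :: "nat \<Rightarrow> nat set" where
  "mult_table N = (\<lambda>(b, q). b * q) ` ({1..N} \<times> {1..N})"

text \<open>An equality \<open>b q = b' q'\<close> factors as \<open>b = s g\<close>, \<open>b' = t g\<close>, \<open>q = t h\<close>, \<open>q' = s h\<close>.\<close>

lemma card_multiplicative_quadruples_le:
  "card {((b, q), (b', q')) \<in> ({1..N} \<times> {1..N}) \<times> ({1..N} \<times> {1..N}). b * q = b' * q'}
    \<le> (card (hyperbolic_pairs N))\<^sup>2" (is "card ?Z \<le> _")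
proof -
  let ?\<phi> = "\<lambda>((s::nat, g::nat), (t::nat, h::nat)). ((s * g, t * h), (t * g, s * h))"
  have "?Z \<subseteq> ?\<phi> ` (hyperbolic_pairs N \<times> hyperbolic_pairs N)"
  proof
    fix z assume "z \<in> ?Z"
    then obtain b q b' q' where z: "z = ((b, q), (b', q'))"
      and r: "b \<in> {1..N}" "q \<in> {1..N}" "b' \<in> {1..N}" "q' \<in> {1..N}" and eq: "b * q = b' * q'"
      by auto
    define g where "g = gcd b b'"
    have "g > 0" using r by (auto simp: g_def)
    obtain s t where st: "b = s * g" "b' = t * g" "coprime s t"
      using gcd_coprime_exists[of b b'] \<open>g > 0\<close> unfolding g_def by blast
    have eq': "s * q = t * q'" using eq st \<open>g > 0\<close> by (simp add: ac_simps)
    then have "t dvd q" using st(3) by (metis coprime_commute coprime_dvd_mult_right_iff dvd_triv_left)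
    then obtain h where h: "q = t * h" by (elim dvdE)
    have "t > 0" using r st by (auto intro: gr0I)
    then have h': "q' = s * h" using eq' h by (simp add: ac_simps)
    have "s \<ge> 1" "g \<ge> 1" "t \<ge> 1" "h \<ge> 1"
      using r st h by (auto simp: Suc_le_eq intro!: gr0I)
    then have "((s, g), (t, h)) \<in> hyperbolic_pairs N \<times> hyperbolic_pairs N"
      using r st h by (auto simp: hyperbolic_pairs_def)
    moreover have "z = ?\<phi> ((s, g), (t, h))" using z st h h' by simp
    ultimately show "z \<in> ?\<phi> ` (hyperbolic_pairs N \<times> hyperbolic_pairs N)" by blast
  qed
  then have "card ?Z \<le> card (hyperbolic_pairs N \<times> hyperbolic_pairs N)"
    by (rule surj_card_le[rotated]) (simp add: finite_hyperbolic_pairs)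
  then show ?thesis by (simp add: card_cartesian_product power2_eq_square)
qed

text \<open>Cauchy-Schwarz over the fibres of multiplication: the fibre sizes sum to
  \<open>N^2\<close>, and the sum of their squares counts the quadruples bounded above by
  \<open>(card (hyperbolic_pairs N))^2\<close>.\<close>

lemma card_mult_table_ge:
  assumes "N \<ge> 1"
  shows "(real N)\<^sup>2 \<le> real (card (mult_table N)) * (1 + ln (real N))\<^sup>2"
proof -
  define S where "S = {1..N} \<times> {1..N}"
  define F where "F n = {x \<in> S. fst x * snd x = n}" for n
  have fin: "finite S" "finite (F n)" "finite (mult_table N)" for n
    by (auto simp: S_def F_def mult_table_def)
  have tab: "a * b \<in> mult_table N" if "a \<in> {1..N}" "b \<in> {1..N}" for a b
    using that unfolding mult_table_def by (intro image_eqI[of _ _ "(a, b)"]) auto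
  have S: "S = (\<Union>n\<in>mult_table N. F n)"
    using tab by (auto simp: S_def F_def)
  have disj: "F n \<inter> F n' = {}" if "n \<noteq> n'" for n n' using that by (auto simp: F_def)
  have "card S = (\<Sum>n\<in>mult_table N. card (F n))"
    unfolding S using fin disj by (intro card_UN_disjoint) auto
  then have "real (card S) = (\<Sum>n\<in>mult_table N. real (card (F n)))" by simp
  then have NF: "(real N)\<^sup>2 = (\<Sum>n\<in>mult_table N. real (card (F n)))"
    by (simp add: S_def power2_eq_square)
  have "(\<Union>n\<in>mult_table N. F n \<times> F n)
      = {((b, q), (b', q')) \<in> ({1..N} \<times> {1..N}) \<times> ({1..N} \<times> {1..N}). b * q = b' * q'}"
    using tab by (auto simp: F_def S_def)
  moreover have "card (\<Union>n\<in>mult_table N. F n \<times> F n) = (\<Sum>n\<in>mult_table N. (card (F n))\<^sup>2)"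
    using fin disj by (subst card_UN_disjoint) (auto simp: card_cartesian_product power2_eq_square)
  ultimately have "(\<Sum>n\<in>mult_table N. (card (F n))\<^sup>2) \<le> (card (hyperbolic_pairs N))\<^sup>2"
    using card_multiplicative_quadruples_le[of N] by simp
  then have E: "(\<Sum>n\<in>mult_table N. (real (card (F n)))\<^sup>2) \<le> (real (card (hyperbolic_pairs N)))\<^sup>2"
    by (simp flip: of_nat_power of_nat_sum)
  have "((real N)\<^sup>2)\<^sup>2 \<le> (\<Sum>n\<in>mult_table N. (real (card (F n)))\<^sup>2) * real (card (mult_table N))"
    unfolding NF by (rule sum_squared_le_sum_of_squares)
  also have "\<dots> \<le> (real N * (1 + ln (real N)))\<^sup>2 * real (card (mult_table N))"
    using card_hyperbolic_pairs_le[OF assms] E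
    by (intro mult_right_mono order.trans[OF E] power_mono) auto
  finally have "(real N)\<^sup>2 * (real N)\<^sup>2 \<le> (real N)\<^sup>2 * (real (card (mult_table N)) * (1 + ln (real N))\<^sup>2)"
    by (simp add: power2_eq_square algebra_simps)
  then show ?thesis by (rule mult_left_le_imp_le) (use assms in simp)
qed

section \<open>Two points of the modular hyperbola in a box\<close>

text \<open>If \<open>x y = c\<close>, then \<open>(x + a, y + b)\<close> lies on the hyperbola
  exactly when \<open>b x + a y + a b = 0\<close>. Multiplying by \<open>x\<close> eliminates
  \<open>y\<close> and leaves a quadratic in \<open>x\<close> whose discriminant is the argument of
  the Legendre symbol.\<close>

lemma card_modular_hyperbola_box_ge_2:
  fixes p H :: nat and a b c :: int
  assumes p: "prime p" "2 < p" and c: "coprime c (int p)"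
    and a: "a \<in> {1..<int H}" "\<not> int p dvd a" and b: "b \<in> {1..<int H}" "\<not> int p dvd b"
    and L: "Legendre (a * b * (a * b - 4 * c)) p \<noteq> -1"
  shows "\<exists>X\<in>{0..int p - 1}. \<exists>Y\<in>{0..int p - 1}.
           card (modular_hyperbola p c \<inter> modular_box p X Y H) \<ge> 2"
proof -
  have pp: "prime (int p)" using p by simp
  have inv: "\<exists>y. [x * y = z] (mod int p)" if x: "\<not> int p dvd x" for x z
  proof -
    have "coprime x (int p)"
      using pp x by (metis coprime_commute prime_imp_coprime)
    then obtain y where "[x * y = 1] (mod int p)" using cong_solve_coprime_int by blast
    then have "[x * (y * z) = z] (mod int p)"
      using cong_scalar_right[of "x * y" 1 "int p" z] by (simp add: mult.assoc)
    then show ?thesis by blast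
  qed
  have p2: "\<not> int p dvd 2" using p zdvd_imp_le[of "int p" 2] by auto
  have p4: "\<not> int p dvd 4"
  proof
    assume "int p dvd 4"
    then have "int p dvd 2 * 2" by simp
    then show False using pp p2 by (metis prime_dvd_mult_iff)
  qed
  have pc: "\<not> int p dvd c"
    using c p by (metis coprime_common_divisor dvd_refl not_prime_unit pp)
  obtain s where s: "[s\<^sup>2 = a * b * (a * b - 4 * c)] (mod int p)"
  proof (cases "[a * b * (a * b - 4 * c) = 0] (mod int p)")
    case True
    then show ?thesis using that[of 0] by (simp add: cong_sym)
  next
    case False
    then show ?thesis using L that by (auto simp: Legendre_def QuadRes_def split: if_splits)
  qed
  have "\<not> int p dvd 2 * b" using pp p2 b by (simp add: prime_dvd_mult_iff)
  \<comment> \<open>The quadratic formula, with \<open>s\<close> a square root of the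
    discriminant.\<close>
  then obtain x where x: "[2 * b * x = s - a * b] (mod int p)" using inv by blast
  have "[(2 * b * x + a * b)\<^sup>2 = (s - a * b + a * b)\<^sup>2] (mod int p)"
    by (intro cong_pow cong_add x cong_refl)
  also have "[(s - a * b + a * b)\<^sup>2 = a * b * (a * b - 4 * c)] (mod int p)" using s by simp
  finally have "int p dvd (2 * b * x + a * b)\<^sup>2 - a * b * (a * b - 4 * c)"
    by (simp add: cong_iff_dvd_diff)
  also have "(2 * b * x + a * b)\<^sup>2 - a * b * (a * b - 4 * c) = 4 * (b * (b * x\<^sup>2 + a * b * x + a * c))"
    by (simp add: power2_eq_square algebra_simps)
  finally have q: "int p dvd b * x\<^sup>2 + a * b * x + a * c"
    using pp p4 b by (simp add: prime_dvd_mult_iff)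
  have "\<not> int p dvd x"
  proof
    assume "int p dvd x"
    then have "int p dvd b * x\<^sup>2 + a * b * x" by (simp add: power2_eq_square)
    then have "int p dvd a * c" using q by (simp add: dvd_add_right_iff)
    then show False using pp a pc by (simp add: prime_dvd_mult_iff)
  qed
  then obtain y where y: "[x * y = c] (mod int p)" using inv by blast
  have "int p dvd (b * x\<^sup>2 + a * b * x + a * c) + a * (x * y - c)"
    using y by (intro dvd_add[OF q] dvd_mult) (simp add: cong_iff_dvd_diff)
  also have "\<dots> = x * (b * x + a * y + a * b)" by (simp add: power2_eq_square algebra_simps)
  finally have *: "int p dvd b * x + a * y + a * b"
    using pp \<open>\<not> int p dvd x\<close> by (simp add: prime_dvd_mult_iff)
  have "int p dvd (x * y - c) + (b * x + a * y + a * b)"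
    using y by (intro dvd_add[OF _ *]) (simp add: cong_iff_dvd_diff)
  then have y': "[(x + a) * (y + b) = c] (mod int p)"
    by (simp add: cong_iff_dvd_diff algebra_simps)
  \<comment> \<open>Offsets in a box start at 1, so its corner lies one below \<open>(x, y)\<close>.
    As \<open>a\<close> and \<open>b\<close> are less than \<open>H\<close>, the offsets
    \<open>a + 1\<close> and \<open>b + 1\<close> of the second point still fit.\<close>
  define X where "X = (x - 1) mod int p"
  define Y where "Y = (y - 1) mod int p"
  define P1 where "P1 = (x mod int p, y mod int p)"
  define P2 where "P2 = ((x + a) mod int p, (y + b) mod int p)"
  have p0: "int p > 0" using p by simp
  have range: "z mod int p \<in> {0..<int p}" for z using p0 by simp
  have "P1 \<in> modular_hyperbola p c" "P2 \<in> modular_hyperbola p c"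
    using y y' p0 by (auto simp: P1_def P2_def modular_hyperbola_def Cong.cong_def mod_mult_eq)
  moreover have "P1 \<in> modular_box p X Y H"
  proof -
    have "[x mod int p = X + 1] (mod int p)" "[y mod int p = Y + 1] (mod int p)"
      by (simp_all add: X_def Y_def Cong.cong_def mod_add_left_eq)
    moreover have "1 \<in> {1..int H}" using a by auto
    ultimately show ?thesis using range unfolding P1_def modular_box_def by blast
  qed
  moreover have "P2 \<in> modular_box p X Y H"
  proof -
    have "[(x + a) mod int p = X + (a + 1)] (mod int p)" "[(y + b) mod int p = Y + (b + 1)] (mod int p)"
      by (simp_all add: X_def Y_def Cong.cong_def mod_add_left_eq)
    moreover have "a + 1 \<in> {1..int H}" "b + 1 \<in> {1..int H}" using a b by auto
    ultimately show ?thesis using range unfolding P2_def modular_box_def by blast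
  qed
  moreover have "P1 \<noteq> P2"
  proof
    assume "P1 = P2"
    then have "(x + a) mod int p = x mod int p" by (simp add: P1_def P2_def)
    then have "int p dvd (x + a) - x" by (simp only: mod_eq_dvd_iff)
    then show False using a by simp
  qed
  moreover have "finite (modular_hyperbola p c)"
    by (rule finite_subset[of _ "{0..<int p} \<times> {0..<int p}"]) (auto simp: modular_hyperbola_def)
  ultimately have "card {P1, P2} \<le> card (modular_hyperbola p c \<inter> modular_box p X Y H)"
    by (intro card_mono) auto
  then have "card (modular_hyperbola p c \<inter> modular_box p X Y H) \<ge> 2" using \<open>P1 \<noteq> P2\<close> by simp
  moreover have "X \<in> {0..int p - 1}" "Y \<in> {0..int p - 1}"
    using p0 by (simp_all add: X_def Y_def)
  ultimately show ?thesis by blast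
qed

text \<open>If no box holds two points, the map sending \<open>n\<close> to \<open>- 4 c / n\<close>
  embeds the multiplication table into the residues with the pattern \<open>- Legendre j p\<close>,
  contradicting \<open>large\<close>. The condition \<open>N\<^sup>2 < p\<close> keeps distinct
  products incongruent.\<close>

lemma modular_hyperbola_box_of_parameters:
  fixes p H N m D :: nat and c :: int
  assumes p: "prime p" "2 < p" and c: "coprime c (int p)"
    and D: "D > 0" "8 * (m + 1) * D\<^sup>2 + 1 \<le> p" and m: "m \<ge> 1" and N: "N\<^sup>2 < p" "N * m < H"
    and large: "D * p + 2 ^ m * (p * m + 3 * m * D) < D * 2 ^ m * card (mult_table N)"
  shows "\<exists>X\<in>{0..int p - 1}. \<exists>Y\<in>{0..int p - 1}.
           card (modular_hyperbola p c \<inter> modular_box p X Y H) \<ge> 2"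
proof (rule ccontr)
  assume contra: "\<not> ?thesis"
  have pp: "prime (int p)" using p by simp
  have p2: "\<not> int p dvd 2" using p zdvd_imp_le[of "int p" 2] by auto
  have pc: "\<not> int p dvd 4 * c"
  proof
    assume "int p dvd 4 * c"
    then have "int p dvd 2 * (2 * c)" by simp
    then have "int p dvd c" using pp p2 by (metis prime_dvd_mult_iff)
    then show False using c p by (metis coprime_common_divisor dvd_refl not_prime_unit pp)
  qed
  have small: "\<not> int p dvd int n" if "0 < n" "n < p" for n
    using that by (meson int_dvd_int_iff nat_dvd_not_less)
  have "m < 8 * (m + 1) * D\<^sup>2 + 1"
    using D(1) by (cases D) (auto simp: power2_eq_square)
  then have mp: "m < p" using D(2) by linarith
  have Np: "N < p" using N(1) by (simp add: power2_eq_square) (metis le_square le_less_trans)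
  have tab: "0 < n" "n < p" if n: "n \<in> mult_table N" for n
  proof -
    obtain b q where "n = b * q" "b \<in> {1..N}" "q \<in> {1..N}" using n by (auto simp: mult_table_def)
    moreover from this have "b * q \<le> N * N" by (intro mult_mono) auto
    ultimately show "0 < n" "n < p" using N(1) by (auto simp: power2_eq_square)
  qed
  have "\<exists>t\<in>{0..<int p}. [int n * t = - 4 * c] (mod int p)" if "n \<in> mult_table N" for n
  proof -
    have "coprime (int n) (int p)"
      using pp small tab[OF that] by (metis coprime_commute prime_imp_coprime)
    then obtain y where y: "[int n * y = 1] (mod int p)" using cong_solve_coprime_int by blast
    have "[int n * (y * (- 4 * c) mod int p) = int n * (y * (- 4 * c))] (mod int p)"
      by (intro cong_scalar_left) (simp add: Cong.cong_def)
    also have "[int n * (y * (- 4 * c)) = - 4 * c] (mod int p)"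
      using cong_scalar_right[OF y, of "- 4 * c"] by (simp add: mult.assoc)
    finally show ?thesis using p by (intro bexI[of _ "y * (- 4 * c) mod int p"]) auto
  qed
  then obtain t where t: "\<And>n. n \<in> mult_table N \<Longrightarrow> t n \<in> {0..<int p}"
    "\<And>n. n \<in> mult_table N \<Longrightarrow> [int n * t n = - 4 * c] (mod int p)" by metis
  have "inj_on t (mult_table N)"
  proof (rule inj_onI)
    fix n n' assume n: "n \<in> mult_table N" "n' \<in> mult_table N" "t n = t n'"
    have "[int n * t n = int n' * t n] (mod int p)"
      using t(2)[OF n(1)] t(2)[OF n(2)] n(3) by (metis cong_sym cong_trans)
    then have "int p dvd t n * (int n - int n')"
      by (simp add: cong_iff_dvd_diff algebra_simps)
    moreover have "\<not> int p dvd t n"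
    proof
      assume "int p dvd t n"
      then have "int p dvd - 4 * c" using t(2)[OF n(1)] by (metis cong_dvd_iff dvd_mult)
      then show False using pc by simp
    qed
    ultimately have "[int n = int n'] (mod int p)"
      using pp by (simp add: prime_dvd_mult_iff cong_iff_dvd_diff)
    then have "int n = int n'"
      using tab[OF n(1)] tab[OF n(2)] by (intro eq_if_cong_of_small_abs) auto
    then show "n = n'" by simp
  qed
  then have "card (mult_table N) = card (t ` mult_table N)" by (simp add: card_image)
  also have "\<dots> \<le> card {x \<in> {0..<int p}. \<forall>j\<in>{1..m}. Legendre (x + int j) p = - Legendre (int j) p}"
  proof (intro card_mono image_subsetI CollectI conjI ballI)
    show "finite {x \<in> {0..<int p}. \<forall>j\<in>{1..m}. Legendre (x + int j) p = - Legendre (int j) p}"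
      by (rule finite_subset[of _ "{0..<int p}"]) auto
    fix n assume n: "n \<in> mult_table N"
    show "t n \<in> {0..<int p}" by (rule t(1)[OF n])
    fix j assume j: "j \<in> {1..m}"
    obtain b q where bq: "n = b * q" "b \<in> {1..N}" "q \<in> {1..N}" using n by (auto simp: mult_table_def)
    \<comment> \<open>Now \<open>a * b = n * j\<close>, so \<open>a * b - 4 * c\<close> is congruent
      to \<open>n * (t n + j)\<close>.\<close>
    define a where "a = q * j"
    have "a \<le> N * m" unfolding a_def using bq j by (intro mult_mono) auto
    moreover have "0 < a" using bq j by (simp add: a_def)
    ultimately have aH: "int a \<in> {1..<int H}" using N(2) by simp
    have "b \<le> N * m" using bq m by (metis atLeastAtMost_iff le_trans mult.right_neutral mult_le_mono2)
    then have bH: "int b \<in> {1..<int H}" using bq N(2) by auto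
    have pb: "\<not> int p dvd int b" using bq Np by (intro small) auto
    have pa: "\<not> int p dvd int a"
      using small[of q] small[of j] pp bq j Np mp by (auto simp: a_def prime_dvd_mult_iff)
    have "Legendre (int a * int b * (int a * int b - 4 * c)) p = -1"
      using card_modular_hyperbola_box_ge_2[OF p c aH pa bH pb] contra by blast
    also have "Legendre (int a * int b * (int a * int b - 4 * c)) p
      = Legendre ((int n * int j) * (int n * (t n + int j))) p"
    proof (rule Legendre_cong)
      have "[int n * int j + int n * t n = int n * int j + - 4 * c] (mod int p)"
        by (intro cong_add cong_refl t(2)[OF n])
      then have "[int n * (t n + int j) = int a * int b - 4 * c] (mod int p)"
        by (simp add: a_def bq algebra_simps)
      moreover have "int a * int b = int n * int j" by (simp add: a_def bq)
      ultimately show "[int a * int b * (int a * int b - 4 * c) = (int n * int j) * (int n * (t n + int j))] (mod int p)"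
        by (metis cong_scalar_left cong_sym)
    qed
    \<comment> \<open>As the product is -1, no factor vanishes. The symbol of \<open>n\<close>
      occurs squared and drops out.\<close>
    finally have "Legendre (int n) p * Legendre (int j) p * (Legendre (int n) p * Legendre (t n + int j) p) = -1"
      by (simp add: Legendre_mult[OF p])
    then show "Legendre (t n + int j) p = - Legendre (int j) p"
      using Legendre_values[of n p] Legendre_values[of j p] Legendre_values[of "t n + j" p] by auto
  qed
  finally have "D * 2 ^ m * card (mult_table N) \<le> D * 2 ^ m * card {x \<in> {0..<int p}. \<forall>j\<in>{1..m}. Legendre (x + int j) p = - Legendre (int j) p}"
    by (rule mult_left_mono) simp
  also have "\<dots> \<le> D * p + 2 ^ m * (p * m + 3 * m * D)"
  proof (rule card_residues_with_character_pattern[OF p D])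
    fix j assume "j \<in> {1..m}"
    then have "\<not> int p dvd int j" using mp by (intro small) auto
    then show "- Legendre (int j) p = 1 \<or> - Legendre (int j) p = -1"
      using Legendre_values[of j p] by (auto simp: Legendre_eq_0_iff[symmetric])
  qed
  finally show False using large by simp
qed

text \<open>In the first inequality the left side is the square root of \<open>x\<close> up to
  powers of logarithms, while the right side grows like \<open>x\<close> to the power
  \<open>1/2 + e\<close>.\<close>

lemma eventually_parameters:
  fixes e :: real
  assumes "0 < e" "e \<le> 1 / 4"
  shows "\<forall>\<^sub>F x in at_top. (1 + ln x)\<^sup>2 * (1 + x * (log 2 x + 1) / (sqrt ((x - 1) / (8 * (log 2 x + 2))) - 1)
           + 3 * (log 2 x + 1)) < (x powr (1 / 4 + e / 2) - 1)\<^sup>2"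
    and "\<forall>\<^sub>F x in at_top. 2 < sqrt ((x - 1) / (8 * (log 2 x + 2)))"
    and "\<forall>\<^sub>F x in at_top. x powr (1 / 4 + e / 2) * (log 2 x + 1) < x powr (1 / 4 + e)"
    and "\<forall>\<^sub>F x in at_top. 2 \<le> x powr (1 / 4 + e / 2)"
  using assms by real_asymp+

lemma modular_hyperbola_box_of_large_prime:
  fixes p H :: nat and c :: int and e :: real
  defines "x \<equiv> real p"
  assumes p: "prime p" "2 < p" and c: "coprime c (int p)" and e: "0 < e" "e \<le> 1 / 4"
    and H: "x powr (1 / 4 + e) \<le> real H"
    and main: "(1 + ln x)\<^sup>2 * (1 + x * (log 2 x + 1) / (sqrt ((x - 1) / (8 * (log 2 x + 2))) - 1)
        + 3 * (log 2 x + 1)) < (x powr (1 / 4 + e / 2) - 1)\<^sup>2"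
    and s2: "2 < sqrt ((x - 1) / (8 * (log 2 x + 2)))"
    and NmH: "x powr (1 / 4 + e / 2) * (log 2 x + 1) < x powr (1 / 4 + e)"
    and N2: "2 \<le> x powr (1 / 4 + e / 2)"
  shows "\<exists>X\<in>{0..int p - 1}. \<exists>Y\<in>{0..int p - 1}.
           card (modular_hyperbola p c \<inter> modular_box p X Y H) \<ge> 2"
proof -
  have x: "x > 2" using p by (simp add: x_def)
  have log1: "1 < log 2 x" using x by (simp add: less_log_iff)
  \<comment> \<open>The least \<open>m\<close> with \<open>2 ^ m\<close> at least \<open>p\<close>,
    so that the term \<open>p / 2 ^ m\<close> is at most 1.\<close>
  define m where "m = nat \<lceil>log 2 x\<rceil>"
  have m: "log 2 x \<le> real m" "real m < log 2 x + 1" using log1 unfolding m_def by linarith+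
  have "m \<ge> 1" using m log1 by linarith
  have x2m: "x \<le> 2 ^ m"
    using m(1) x by (simp add: log_le_iff powr_realpow)
  define y where "y = sqrt ((x - 1) / (8 * (real m + 1)))"
  \<comment> \<open>A lower bound for \<open>y\<close> without the rounding in \<open>m\<close>, in
    the form used by the asymptotic hypotheses.\<close>
  define z where "z = sqrt ((x - 1) / (8 * (log 2 x + 2)))"
  have zy: "z \<le> y"
    unfolding y_def z_def using m log1 x by (intro real_sqrt_le_mono divide_left_mono) auto
  have z2: "2 < z" using s2 by (simp only: z_def)
  \<comment> \<open>The largest integer with
    \<open>8 * (m + 1) * D\<^sup>2 + 1 \<le> p\<close>.\<close>
  define D where "D = nat \<lfloor>y\<rfloor>"
  have y2: "2 < y" using z2 zy by simp
  have D: "real D \<le> y" "y - 1 < real D" using y2 unfolding D_def by linarith+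
  have D0: "D > 0" using D y2 by linarith
  have "(real D)\<^sup>2 \<le> y\<^sup>2" using D by (intro power_mono) auto
  also have "y\<^sup>2 = (x - 1) / (8 * (real m + 1))" using x by (simp add: y_def)
  finally have "8 * (real m + 1) * (real D)\<^sup>2 + 1 \<le> x" by (simp add: field_simps)
  then have "real (8 * (m + 1) * D\<^sup>2 + 1) \<le> real p" by (simp add: x_def algebra_simps)
  then have Dp: "8 * (m + 1) * D\<^sup>2 + 1 \<le> p" by (simp only: of_nat_le_iff)
  define w where "w = x powr (1 / 4 + e / 2)"
  define N where "N = nat \<lfloor>w\<rfloor>"
  have w2: "2 \<le> w" using N2 by (simp add: w_def)
  have N: "real N \<le> w" "w - 1 < real N" using w2 unfolding N_def by linarith+
  have N1: "N \<ge> 1" using N w2 by linarith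
  have "(real N)\<^sup>2 \<le> w\<^sup>2" using N by (intro power_mono) auto
  \<comment> \<open>The bound \<open>e \<le> 1 / 4\<close> keeps this exponent below 1.\<close>
  also have "w\<^sup>2 = x powr (1 / 2 + e)" using x by (simp add: w_def power2_eq_square flip: powr_add)
  also have "\<dots> < x powr 1" using x e by (intro powr_less_mono) auto
  finally have "(real N)\<^sup>2 < x" using x by simp
  then have Np: "N\<^sup>2 < p" by (simp add: x_def flip: of_nat_power)
  have "real N * real m \<le> w * (log 2 x + 1)" using N m w2 by (intro mult_mono) auto
  also have "\<dots> < x powr (1 / 4 + e)" using NmH by (simp add: w_def)
  also note H
  finally have NH: "N * m < H" by (simp flip: of_nat_mult)
  define T where "T = real (card (mult_table N))"
  have "N \<le> p" using Np le_square[of N] unfolding power2_eq_square by linarith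
  then have lnN: "0 \<le> 1 + ln (real N)" "1 + ln (real N) \<le> 1 + ln x"
    using N1 by (simp_all add: x_def)
  have "(w - 1)\<^sup>2 \<le> (real N)\<^sup>2" using N w2 by (intro power_mono) auto
  also have "\<dots> \<le> T * (1 + ln (real N))\<^sup>2" unfolding T_def by (rule card_mult_table_ge[OF N1])
  also have "\<dots> \<le> T * (1 + ln x)\<^sup>2"
    using lnN by (intro mult_left_mono power_mono) (auto simp: T_def)
  finally have "(1 + ln x)\<^sup>2 * (1 + x * (log 2 x + 1) / (z - 1) + 3 * (log 2 x + 1)) < (1 + ln x)\<^sup>2 * T"
    using main by (simp add: w_def z_def mult.commute)
  then have T: "1 + x * (log 2 x + 1) / (z - 1) + 3 * (log 2 x + 1) < T"
    by (rule mult_left_less_imp_less) simp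
  have "x * real m / real D \<le> x * (log 2 x + 1) / (z - 1)"
    using m D zy z2 x log1 by (intro frac_le mult_mono) auto
  moreover have "x / 2 ^ m \<le> 1" using x2m by simp
  ultimately have "x / 2 ^ m + x * real m / real D + 3 * real m
      \<le> 1 + x * (log 2 x + 1) / (z - 1) + 3 * (log 2 x + 1)"
    using m by (intro add_mono) auto
  then have "x / 2 ^ m + x * real m / real D + 3 * real m < T" using T by (rule le_less_trans)
  \<comment> \<open>The inequality \<open>large\<close> of the parameter lemma, recovered from its
    version divided by \<open>D * 2 ^ m\<close>.\<close>
  then have "real D * 2 ^ m * (x / 2 ^ m + x * real m / real D + 3 * real m) < real D * 2 ^ m * T"
    using D0 by (intro mult_strict_left_mono) auto
  also have "real D * 2 ^ m * (x / 2 ^ m + x * real m / real D + 3 * real m)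
      = real D * x + 2 ^ m * (x * real m + 3 * real m * real D)"
    using D0 by (simp add: field_simps)
  finally have "real (D * p + 2 ^ m * (p * m + 3 * m * D)) < real (D * 2 ^ m * card (mult_table N))"
    by (simp add: x_def T_def)
  then have "D * p + 2 ^ m * (p * m + 3 * m * D) < D * 2 ^ m * card (mult_table N)"
    by (simp only: of_nat_less_iff)
  with modular_hyperbola_box_of_parameters[OF p c D0 Dp \<open>m \<ge> 1\<close> Np NH] show ?thesis .
qed

text \<open>Serves the small primes. Taking \<open>a = 1\<close> and \<open>b = 4 c mod p\<close>,
  which is less than \<open>H\<close>, makes the discriminant vanish modulo
  \<open>p\<close>.\<close>

lemma modular_hyperbola_box_of_full_side:
  fixes p H :: nat and c :: int
  assumes p: "prime p" "2 < p" and c: "coprime c (int p)" and H: "p < H"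
  shows "\<exists>X\<in>{0..int p - 1}. \<exists>Y\<in>{0..int p - 1}.
           card (modular_hyperbola p c \<inter> modular_box p X Y H) \<ge> 2"
proof -
  define b where "b = 4 * c mod int p"
  have "coprime 2 (int p)" using p prime_odd_nat by simp
  then have "coprime (2 * (2 * c)) (int p)" using c by (simp only: coprime_mult_left_iff)
  then have "coprime b (int p)" using p by (simp add: b_def coprime_mod_left_iff)
  then have pb: "\<not> int p dvd b"
    using p by (metis coprime_common_divisor dvd_refl not_prime_unit prime_nat_int_transfer)
  then have "b \<noteq> 0" by auto
  moreover have "0 \<le> b" "b < int p" using p by (simp_all add: b_def)
  ultimately have bH: "b \<in> {1..<int H}" using H by simp
  have 1: "1 \<in> {1..<int H}" "\<not> int p dvd 1" using p H by simp_all
  have "int p dvd b - 4 * c" by (simp add: b_def mod_eq_dvd_iff[symmetric])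
  then have "Legendre (1 * b * (1 * b - 4 * c)) p = 0" by (simp add: Legendre_eq_0_iff)
  then have "Legendre (1 * b * (1 * b - 4 * c)) p \<noteq> -1" by simp
  then show ?thesis by (rule card_modular_hyperbola_box_ge_2[OF p c 1 bH pb])
qed

theorem theorem1:
  "\<forall>\<epsilon>::real. \<epsilon> > 0 \<longrightarrow>
     (\<exists>C::real. C > 0 \<and>
       (\<forall>(p::nat) (c::int) (H::nat).
          prime p \<longrightarrow> p > 2 \<longrightarrow> coprime c (int p) \<longrightarrow> H > 0 \<longrightarrow>
          real H \<ge> C * real p powr (1 / 4 + \<epsilon>) \<longrightarrow>
          (\<exists>X\<in>{0..int p - 1}. \<exists>Y\<in>{0..int p - 1}.
             card (modular_hyperbola p c \<inter> modular_box p X Y H) \<ge> 2)))"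
proof (intro allI impI)
  fix \<epsilon> :: real
  assume "\<epsilon> > 0"
  \<comment> \<open>Capping the exponent only weakens the demand on \<open>H\<close>, and it secures
    the bound \<open>e \<le> 1 / 4\<close> needed for large primes.\<close>
  define e where "e = min \<epsilon> (1 / 4)"
  have e: "0 < e" "e \<le> 1 / 4" "e \<le> \<epsilon>" using \<open>\<epsilon> > 0\<close> by (auto simp: e_def)
  have "\<forall>\<^sub>F x in at_top. (1 + ln x)\<^sup>2 * (1 + x * (log 2 x + 1) / (sqrt ((x - 1) / (8 * (log 2 x + 2))) - 1)
        + 3 * (log 2 x + 1)) < (x powr (1 / 4 + e / 2) - 1)\<^sup>2
      \<and> 2 < sqrt ((x - 1) / (8 * (log 2 x + 2)))
      \<and> x powr (1 / 4 + e / 2) * (log 2 x + 1) < x powr (1 / 4 + e)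
      \<and> 2 \<le> x powr (1 / 4 + e / 2)" (is "eventually ?P at_top")
    by (intro eventually_conj eventually_parameters[OF e(1,2)])
  then obtain x0 where x0: "\<And>x. x \<ge> x0 \<Longrightarrow> ?P x" by (auto simp: eventually_at_top_linorder)
  \<comment> \<open>For primes below \<open>x0\<close> this constant alone exceeds \<open>p\<close>,
    hence forces \<open>H > p\<close>. Being at least 1, it also serves the large primes.\<close>
  define C where "C = max 1 (x0 + 1)"
  have "\<exists>X\<in>{0..int p - 1}. \<exists>Y\<in>{0..int p - 1}.
           card (modular_hyperbola p c \<inter> modular_box p X Y H) \<ge> 2"
    if p: "prime p" "2 < p" and c: "coprime c (int p)" and H: "real H \<ge> C * real p powr (1 / 4 + \<epsilon>)"
    for p H :: nat and c :: int
  proof (cases "real p \<ge> x0")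
    case True
    have "real p powr (1 / 4 + e) \<le> 1 * real p powr (1 / 4 + \<epsilon>)"
      using p e by (simp add: powr_mono)
    also have "\<dots> \<le> C * real p powr (1 / 4 + \<epsilon>)" by (intro mult_right_mono) (auto simp: C_def)
    also note H
    finally show ?thesis
      using modular_hyperbola_box_of_large_prime[OF p c e(1,2)] x0[OF True] by blast
  next
    case False
    have "real p < C" using False by (simp add: C_def)
    also have "C * 1 \<le> C * real p powr (1 / 4 + \<epsilon>)"
      using p \<open>\<epsilon> > 0\<close> by (intro mult_left_mono ge_one_powr_ge_zero) (auto simp: C_def)
    also note H
    finally show ?thesis using modular_hyperbola_box_of_full_side[OF p c] by simp
  qed
  then show "\<exists>C::real. C > 0 \<and>
       (\<forall>(p::nat) (c::int) (H::nat).
          prime p \<longrightarrow> p > 2 \<longrightarrow> coprime c (int p) \<longrightarrow> H > 0 \<longrightarrow>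
          real H \<ge> C * real p powr (1 / 4 + \<epsilon>) \<longrightarrow>
          (\<exists>X\<in>{0..int p - 1}. \<exists>Y\<in>{0..int p - 1}.
             card (modular_hyperbola p c \<inter> modular_box p X Y H) \<ge> 2))"
    by (intro exI[of _ C]) (auto simp: C_def)
qed

end
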